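(* Let $(M,F)$ be an AR-Finsler manifold. Then the mean Cartan torsion is rational in $y$, i.e. each component $I_k(x,y)$ is a rational function in $y$.
   Context: $M$ is a smooth $n$-dimensional manifold with local coordinates $(x^i)$ and induced fibre coordinates $(y^i)$ on $TM$; $\dot{\partial}_i=\partial/\partial y^i$; the summation convention is used. A Finsler metric on $M$ is a map $F:TM\to[0,\infty)$ which is $C^\infty$ on $TM\setminus\{0\}$, positively homogeneous of degree one in $y$, and such that $g_{ij}(x,y):=\frac12\dot{\partial}_i\dot{\partial}_jF^2$ is positive definite at each point of $TM\setminus\{0\}$; $(g^{ij})$ is the inverse matrix. "Rational in $y$" means: locally in $x$, a quotient of two polynomials in $y$ whose coefficients are smooth functions of $x$. $F$ is an AR-Finsler metric (and $(M,F)$ an AR-Finsler manifold) if $g_{ij}(x,y)=\eta(x,y)\,a_{ij}(x,y)$ where (a) $\eta:TM\setminus\{0\}\to[0,\infty)$ is smooth; (b) $(a_{ij}(x,y))$ is a symmetric positive definite matrix with each $a_{ij}$ rational in $y$; (c) each product $\eta\,a_{ij}$ is positively homogeneous of degree zero in $y$. Cartan torsion: $C_{ijk}=\frac12\dot{\partial}_kg_{ij}$; mean Cartan torsion: $I_k=g^{ij}C_{ijk}$. *)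

theory Defs
  imports "HOL-Analysis.Analysis"
begin

section \<open>Smooth maps between normed spaces\<close>

primrec higher_differentiable_on ::
  "nat \<Rightarrow> ('a::real_normed_vector \<Rightarrow> 'b::real_normed_vector) \<Rightarrow> 'a set \<Rightarrow> bool" where
  "higher_differentiable_on 0 f S \<longleftrightarrow> continuous_on S f"
| "higher_differentiable_on (Suc k) f S \<longleftrightarrow>
     (\<forall>x\<in>S. f differentiable (at x)) \<and>
     (\<forall>v. higher_differentiable_on k (\<lambda>x. frechet_derivative f (at x) v) S)"

text \<open>\<open>C\<^sup>\<infinity>\<close> on \<open>S\<close>; only meaningful, and only used, for open \<open>S\<close>.\<close>
definition smooth_on :: "'a set \<Rightarrow> ('a::real_normed_vector \<Rightarrow> 'b::real_normed_vector) \<Rightarrow> bool" where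
  "smooth_on S f \<longleftrightarrow> (\<forall>k. higher_differentiable_on k f S)"


section \<open>Smooth manifolds\<close>

text \<open>A chart \<open>(U, \<phi>)\<close> consists of its domain and its coordinate map; the values of \<open>\<phi>\<close> outside
  \<open>U\<close> are irrelevant. The dimension is \<open>CARD('n)\<close>.\<close>
type_synonym ('m, 'n) chart = "'m set \<times> ('m \<Rightarrow> real ^ 'n)"

definition coord_range :: "('m, 'n::finite) chart \<Rightarrow> (real ^ 'n) set" where
  "coord_range c = snd c ` fst c"

definition is_chart :: "'m topology \<Rightarrow> ('m, 'n::finite) chart \<Rightarrow> bool" where
  "is_chart M c \<longleftrightarrow>
     openin M (fst c) \<and> open (coord_range c) \<and>
     homeomorphic_map (subtopology M (fst c)) (top_of_set (coord_range c)) (snd c)"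

definition transition ::
  "('m, 'n::finite) chart \<Rightarrow> ('m, 'n) chart \<Rightarrow> real ^ 'n \<Rightarrow> real ^ 'n" where
  "transition c d = (\<lambda>x. snd d (inv_into (fst c) (snd c) x))"

definition smoothly_compatible :: "('m, 'n::finite) chart \<Rightarrow> ('m, 'n) chart \<Rightarrow> bool" where
  "smoothly_compatible c d \<longleftrightarrow>
     smooth_on (snd c ` (fst c \<inter> fst d)) (transition c d) \<and>
     smooth_on (snd d ` (fst c \<inter> fst d)) (transition d c)"

definition smooth_manifold :: "'m topology \<Rightarrow> ('m, 'n::finite) chart set \<Rightarrow> bool" where
  "smooth_manifold M A \<longleftrightarrow>
     Hausdorff_space M \<and> second_countable M \<and>
     (\<forall>c\<in>A. is_chart M c) \<and> (\<Union>c\<in>A. fst c) = topspace M \<and>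
     (\<forall>c\<in>A. \<forall>d\<in>A. smoothly_compatible c d) \<and>
     (\<forall>c. is_chart M c \<and> (\<forall>d\<in>A. smoothly_compatible c d) \<longrightarrow> c \<in> A)"


section \<open>The tangent bundle\<close>

text \<open>A tangent vector at \<open>p\<close> is the family of its component vectors with respect to all charts
  around \<open>p\<close>, any two of which are related by the Jacobian of the change of coordinates. The family
  is indexed by all pairs \<open>(U, \<phi>)\<close>, with the dummy value \<open>0\<close> where \<open>(U, \<phi>)\<close> is not a chart
  around \<open>p\<close>.\<close>
type_synonym ('m, 'n) tangent_vector = "'m \<times> (('m, 'n) chart \<Rightarrow> real ^ 'n)"

definition tangent_space ::
  "('m, 'n::finite) chart set \<Rightarrow> 'm \<Rightarrow> (('m, 'n) chart \<Rightarrow> real ^ 'n) set" where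
  "tangent_space A p =
     {v. (\<forall>c\<in>A. \<forall>d\<in>A. p \<in> fst c \<inter> fst d \<longrightarrow>
            v d = frechet_derivative (transition c d) (at (snd c p)) (v c)) \<and>
         (\<forall>c. \<not> (c \<in> A \<and> p \<in> fst c) \<longrightarrow> v c = 0)}"

definition tangent_bundle ::
  "'m topology \<Rightarrow> ('m, 'n::finite) chart set \<Rightarrow> ('m, 'n) tangent_vector set" where
  "tangent_bundle M A = Sigma (topspace M) (tangent_space A)"

definition slit_tangent_bundle ::
  "'m topology \<Rightarrow> ('m, 'n::finite) chart set \<Rightarrow> ('m, 'n) tangent_vector set" where
  "slit_tangent_bundle M A = tangent_bundle M A - (topspace M \<times> {\<lambda>c. 0})"

definition induced_coords ::
  "('m, 'n::finite) chart \<Rightarrow> ('m, 'n) tangent_vector \<Rightarrow> (real ^ 'n) \<times> (real ^ 'n)" where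
  "induced_coords c w = (snd c (fst w), snd w c)"

text \<open>The expression \<open>f(x, y)\<close> of a function on \<open>TM\<close> in the coordinates induced by a chart. For
  \<open>c \<in> A\<close> the map inverted here is a bijection onto \<open>coord_range c \<times> UNIV\<close>.\<close>
definition local_rep ::
  "('m, 'n::finite) chart set \<Rightarrow> ('m, 'n) chart \<Rightarrow> (('m, 'n) tangent_vector \<Rightarrow> real) \<Rightarrow>
     real ^ 'n \<Rightarrow> real ^ 'n \<Rightarrow> real" where
  "local_rep A c f x y = f (inv_into (Sigma (fst c) (tangent_space A)) (induced_coords c) (x, y))"

definition smooth_on_slit ::
  "('m, 'n::finite) chart set \<Rightarrow> (('m, 'n) tangent_vector \<Rightarrow> real) \<Rightarrow> bool" where
  "smooth_on_slit A f \<longleftrightarrow>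
     (\<forall>c\<in>A. smooth_on (coord_range c \<times> (UNIV - {0})) (\<lambda>(x, y). local_rep A c f x y))"


section \<open>Finsler metrics\<close>

definition fibre_deriv ::
  "'n::finite \<Rightarrow> (real ^ 'n \<Rightarrow> real ^ 'n \<Rightarrow> real) \<Rightarrow> real ^ 'n \<Rightarrow> real ^ 'n \<Rightarrow> real" where
  "fibre_deriv i f x y = deriv (\<lambda>t. f x (y + t *\<^sub>R axis i 1)) 0"

definition pos_definite :: "real ^ 'n ^ 'n::finite \<Rightarrow> bool" where
  "pos_definite B \<longleftrightarrow> (\<forall>v. v \<noteq> 0 \<longrightarrow> v \<bullet> (B *v v) > 0)"

definition metric_tensor ::
  "('m, 'n::finite) chart set \<Rightarrow> ('m, 'n) chart \<Rightarrow> (('m, 'n) tangent_vector \<Rightarrow> real) \<Rightarrow>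
     real ^ 'n \<Rightarrow> real ^ 'n \<Rightarrow> real ^ 'n ^ 'n" where
  "metric_tensor A c F x y =
     (\<chi> i j. 1/2 * fibre_deriv i (fibre_deriv j (local_rep A c (\<lambda>w. (F w)\<^sup>2))) x y)"

definition finsler_metric ::
  "'m topology \<Rightarrow> ('m, 'n::finite) chart set \<Rightarrow> (('m, 'n) tangent_vector \<Rightarrow> real) \<Rightarrow> bool" where
  "finsler_metric M A F \<longleftrightarrow>
     (\<forall>w\<in>tangent_bundle M A. F w \<ge> 0) \<and>
     smooth_on_slit A F \<and>
     (\<forall>(p, v)\<in>tangent_bundle M A. \<forall>l>0. F (p, \<lambda>c. l *\<^sub>R v c) = l * F (p, v)) \<and>
     (\<forall>c\<in>A. \<forall>x\<in>coord_range c. \<forall>y. y \<noteq> 0 \<longrightarrow> pos_definite (metric_tensor A c F x y))"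

definition cartan_torsion ::
  "('m, 'n::finite) chart set \<Rightarrow> ('m, 'n) chart \<Rightarrow> (('m, 'n) tangent_vector \<Rightarrow> real) \<Rightarrow>
     'n \<Rightarrow> 'n \<Rightarrow> 'n \<Rightarrow> real ^ 'n \<Rightarrow> real ^ 'n \<Rightarrow> real" where
  "cartan_torsion A c F i j k x y =
     1/2 * fibre_deriv k (\<lambda>x y. metric_tensor A c F x y $ i $ j) x y"

definition mean_cartan_torsion ::
  "('m, 'n::finite) chart set \<Rightarrow> ('m, 'n) chart \<Rightarrow> (('m, 'n) tangent_vector \<Rightarrow> real) \<Rightarrow>
     'n \<Rightarrow> real ^ 'n \<Rightarrow> real ^ 'n \<Rightarrow> real" where
  "mean_cartan_torsion A c F k x y =
     (\<Sum>i\<in>UNIV. \<Sum>j\<in>UNIV.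
        matrix_inv (metric_tensor A c F x y) $ i $ j * cartan_torsion A c F i j k x y)"


section \<open>Rationality in the fibre coordinates and AR-Finsler metrics\<close>

text \<open>\<open>S\<close> is the set of multi-indices (exponent vectors) that occur.\<close>
definition polynomial_in_fibre ::
  "(real ^ 'n::finite) set \<Rightarrow> (real ^ 'n \<Rightarrow> real ^ 'n \<Rightarrow> real) \<Rightarrow> bool" where
  "polynomial_in_fibre W P \<longleftrightarrow>
     (\<exists>(S :: ('n \<Rightarrow> nat) set) coef.
        finite S \<and> (\<forall>\<alpha>\<in>S. smooth_on W (coef \<alpha>)) \<and>
        (\<forall>x\<in>W. \<forall>y. P x y = (\<Sum>\<alpha>\<in>S. coef \<alpha> x * (\<Prod>i\<in>UNIV. (y $ i) ^ \<alpha> i))))"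

text \<open>The functions concerned live on the slit tangent bundle, so the denominator has
  no zero with \<open>y \<noteq> 0\<close>.\<close>
definition rational_in_fibre ::
  "(real ^ 'n::finite) set \<Rightarrow> (real ^ 'n \<Rightarrow> real ^ 'n \<Rightarrow> real) \<Rightarrow> bool" where
  "rational_in_fibre D f \<longleftrightarrow>
     (\<forall>x0\<in>D. \<exists>W P Q. open W \<and> x0 \<in> W \<and> W \<subseteq> D \<and>
        polynomial_in_fibre W P \<and> polynomial_in_fibre W Q \<and>
        (\<forall>x\<in>W. \<forall>y. y \<noteq> 0 \<longrightarrow> Q x y \<noteq> 0 \<and> f x y = P x y / Q x y))"

definition AR_finsler_metric ::
  "'m topology \<Rightarrow> ('m, 'n::finite) chart set \<Rightarrow> (('m, 'n) tangent_vector \<Rightarrow> real) \<Rightarrow> bool" where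
  "AR_finsler_metric M A F \<longleftrightarrow>
     finsler_metric M A F \<and>
     (\<exists>\<eta>. (\<forall>w\<in>slit_tangent_bundle M A. \<eta> w \<ge> 0) \<and> smooth_on_slit A \<eta> \<and>
        (\<forall>c\<in>A. \<exists>a :: real ^ 'n \<Rightarrow> real ^ 'n \<Rightarrow> real ^ 'n ^ 'n.
           (\<forall>x\<in>coord_range c. \<forall>y. y \<noteq> 0 \<longrightarrow>
              transpose (a x y) = a x y \<and> pos_definite (a x y)) \<and>
           (\<forall>i j. rational_in_fibre (coord_range c) (\<lambda>x y. a x y $ i $ j)) \<and>
           (\<forall>x\<in>coord_range c. \<forall>y. y \<noteq> 0 \<longrightarrow> (\<forall>l>0. \<forall>i j.
              local_rep A c \<eta> x (l *\<^sub>R y) * a x (l *\<^sub>R y) $ i $ j =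
              local_rep A c \<eta> x y * a x y $ i $ j)) \<and>
           (\<forall>x\<in>coord_range c. \<forall>y. y \<noteq> 0 \<longrightarrow> (\<forall>i j.
              metric_tensor A c F x y $ i $ j = local_rep A c \<eta> x y * a x y $ i $ j))))"

end

(* Write g = eta a. Since g_ij is homogeneous of degree zero, Euler's theorem gives
   y^k C_ijk = 0, and by the total symmetry of C also y^i C_ijk = 0. Expanding
   2 C_ijk = (d_k eta) a_ij + eta d_k a_ij and contracting with y^i y^j yields
     (d_k eta) / eta = - y^i y^j d_k a_ij / (a_ij y^i y^j),
   which is rational although eta itself need not be. As g^-1 = a^-1 / eta, the factor eta cancels
   in I_k = g^ij C_ijk, which leaves a rational expression in a, its fibre derivatives, a^-1 (Cramer)
   and the quotient above. *)

theory Submission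
  imports Defs
begin

section \<open>Calculus of smooth maps\<close>

text \<open>The obstacle is that \<open>\<eta>\<close> is merely smooth, so closure properties of
  rational functions say nothing about it or its derivatives. Contracting with y^i y^j condenses the
  matrix identity into one scalar equation, linear in d_k eta with coefficient a_ij y^i y^j. The
  symmetry of C is analytic, not algebraic: the g_ij are second fibre derivatives of F^2 / 2, so
  exchanging the differentiation index with a matrix index means commuting two fibre derivatives.
  This rests on the symmetry of second Frechet derivatives, proved here for
  \<open>smooth_on\<close>. Denominators may not vanish for y \<noteq> 0, so every division needs
  its own argument: a_ij y^i y^j and det a are nonzero because a is positive definite. Cancelling
  eta is legitimate because g is positive definite; the definition itself gives only eta \<ge> 0.
  The entries of a are differentiable along the fibres because they are rational, which makes the
  product rule for eta a available.\<close>

lemma higher_differentiable_on_cong: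
  assumes "open S" "\<And>x. x \<in> S \<Longrightarrow> f x = g x" "higher_differentiable_on k f S"
  shows "higher_differentiable_on k g S"
  using assms(2,3)
proof (induction k arbitrary: f g)
  case 0
  then show ?case by (simp cong: continuous_on_cong)
next
  case (Suc k)
  have fd: "f differentiable (at x)" if "x \<in> S" for x
    using Suc.prems(2) that by simp
  have gd: "g differentiable (at x)" if "x \<in> S" for x
    using fd[OF that] Suc.prems(1) assms(1) that
    by (meson differentiable_def has_derivative_transform_within_open)
  have eq: "frechet_derivative f (at x) v = frechet_derivative g (at x) v" if "x \<in> S" for x v
    using frechet_derivative_transform_within_open[OF fd[OF that] assms(1) that Suc.prems(1)]
    by simp
  have "higher_differentiable_on k (\<lambda>x. frechet_derivative g (at x) v) S" for v
    by (rule Suc.IH[of "\<lambda>x. frechet_derivative f (at x) v"]) (use eq Suc.prems(2) in auto)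
  with gd show ?case by simp
qed

lemma higher_differentiable_on_subset:
  "higher_differentiable_on k f S \<Longrightarrow> T \<subseteq> S \<Longrightarrow> higher_differentiable_on k f T"
  by (induction k arbitrary: f) (auto intro: continuous_on_subset)

text \<open>The product rule keeps one factor undifferentiated; lowering its order by one makes it
  fit the induction hypothesis there.\<close>

lemma higher_differentiable_on_SucD:
  "higher_differentiable_on (Suc k) f S \<Longrightarrow> higher_differentiable_on k f S"
proof (induction k arbitrary: f)
  case 0
  then show ?case
    by (auto intro!: continuous_at_imp_continuous_on differentiable_imp_continuous_within)
next
  case (Suc k)
  then show ?case by (metis higher_differentiable_on.simps(2))
qed

lemma higher_differentiable_on_const: "higher_differentiable_on k (\<lambda>x. c) S"
  by (induction k arbitrary: c) auto

lemma higher_differentiable_on_add: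
  assumes "open S" "higher_differentiable_on k f S" "higher_differentiable_on k g S"
  shows "higher_differentiable_on k (\<lambda>x. f x + g x) S"
  using assms(2,3)
proof (induction k arbitrary: f g)
  case 0
  then show ?case by (auto intro: continuous_on_add)
next
  case (Suc k)
  have der: "frechet_derivative (\<lambda>x. f x + g x) (at x) =
      (\<lambda>v. frechet_derivative f (at x) v + frechet_derivative g (at x) v)" if "x \<in> S" for x
    using Suc.prems that
    by (intro frechet_derivative_at[symmetric] has_derivative_add)
      (auto simp: frechet_derivative_works[symmetric])
  have "higher_differentiable_on k (\<lambda>x. frechet_derivative (\<lambda>x. f x + g x) (at x) v) S" for v
    by (rule higher_differentiable_on_cong[OF assms(1) _ Suc.IH[of
      "\<lambda>x. frechet_derivative f (at x) v" "\<lambda>x. frechet_derivative g (at x) v"]])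
      (use der Suc.prems in auto)
  with Suc.prems show ?case by auto
qed

lemma higher_differentiable_on_mult:
  fixes f g :: "'a::real_normed_vector \<Rightarrow> real"
  assumes "open S" "higher_differentiable_on k f S" "higher_differentiable_on k g S"
  shows "higher_differentiable_on k (\<lambda>x. f x * g x) S"
  using assms(2,3)
proof (induction k arbitrary: f g)
  case 0
  then show ?case by (auto intro: continuous_on_mult)
next
  case (Suc k)
  have der: "frechet_derivative (\<lambda>x. f x * g x) (at x) =
      (\<lambda>v. f x * frechet_derivative g (at x) v + frechet_derivative f (at x) v * g x)"
    if "x \<in> S" for x
    using Suc.prems that
    by (intro frechet_derivative_at[symmetric] has_derivative_mult)
      (auto simp: frechet_derivative_works[symmetric])
  have "higher_differentiable_on k (\<lambda>x. frechet_derivative (\<lambda>x. f x * g x) (at x) v) S" for v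
  proof (rule higher_differentiable_on_cong[OF assms(1) _ higher_differentiable_on_add[OF assms(1)
        Suc.IH[of f "\<lambda>x. frechet_derivative g (at x) v"]
        Suc.IH[of "\<lambda>x. frechet_derivative f (at x) v" g]]])
  qed (use der Suc.prems higher_differentiable_on_SucD in auto)
  with Suc.prems show ?case by auto
qed

lemma smooth_on_subset: "smooth_on S f \<Longrightarrow> T \<subseteq> S \<Longrightarrow> smooth_on T f"
  unfolding smooth_on_def using higher_differentiable_on_subset by blast

lemma smooth_on_cong:
  assumes "open S" "\<And>x. x \<in> S \<Longrightarrow> f x = g x" "smooth_on S f"
  shows "smooth_on S g"
  using assms higher_differentiable_on_cong unfolding smooth_on_def by blast

lemma smooth_on_const: "smooth_on S (\<lambda>x. c)"
  by (simp add: smooth_on_def higher_differentiable_on_const)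

lemma smooth_on_add:
  "open S \<Longrightarrow> smooth_on S f \<Longrightarrow> smooth_on S g \<Longrightarrow> smooth_on S (\<lambda>x. f x + g x)"
  by (simp add: smooth_on_def higher_differentiable_on_add)

lemma smooth_on_mult:
  fixes f g :: "'a::real_normed_vector \<Rightarrow> real"
  shows "open S \<Longrightarrow> smooth_on S f \<Longrightarrow> smooth_on S g \<Longrightarrow> smooth_on S (\<lambda>x. f x * g x)"
  by (simp add: smooth_on_def higher_differentiable_on_mult)

lemma smooth_on_imp_differentiable: "smooth_on S f \<Longrightarrow> x \<in> S \<Longrightarrow> f differentiable (at x)"
  unfolding smooth_on_def by (metis higher_differentiable_on.simps(2))

lemma smooth_on_frechet_derivative:
  "smooth_on S f \<Longrightarrow> smooth_on S (\<lambda>x. frechet_derivative f (at x) v)"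
  unfolding smooth_on_def by (metis higher_differentiable_on.simps(2))

section \<open>Directional derivatives and the symmetry of second derivatives\<close>

lemma has_real_derivative_along_line:
  fixes f :: "'a::real_normed_vector \<Rightarrow> real"
  assumes "f differentiable (at (p + s *\<^sub>R u))"
  shows "((\<lambda>s. f (p + s *\<^sub>R u)) has_real_derivative
           frechet_derivative f (at (p + s *\<^sub>R u)) u) (at s)"
proof -
  let ?D = "frechet_derivative f (at (p + s *\<^sub>R u))"
  have "(f has_derivative ?D) (at (p + s *\<^sub>R u))"
    using assms frechet_derivative_works by blast
  moreover have "((\<lambda>s. p + s *\<^sub>R u) has_derivative (\<lambda>h. h *\<^sub>R u)) (at s)"
    by (auto intro!: derivative_eq_intros)
  ultimately have "((\<lambda>s. f (p + s *\<^sub>R u)) has_derivative (\<lambda>h. ?D (h *\<^sub>R u))) (at s)"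
    using has_derivative_compose by blast
  moreover have "?D (h *\<^sub>R u) = ?D u * h" for h
    using linear_frechet_derivative[OF assms] by (simp add: linear_cmul)
  ultimately show ?thesis
    by (simp add: has_field_derivative_def)
qed

text \<open>The mean value theorem is applied twice: to the increment in direction \<open>v\<close>
  as a function of the step in direction \<open>u\<close>, and then to the directional derivative
  along \<open>u\<close> as a function of the step in direction \<open>v\<close>. The bound on
  \<open>t\<close> keeps the whole parallelogram inside the ball.\<close>

lemma second_difference_mean_value:
  fixes f :: "'a::real_normed_vector \<Rightarrow> real"
  assumes sub: "ball x d \<subseteq> S" and f: "\<And>z. z \<in> S \<Longrightarrow> f differentiable (at z)"
    and fu: "\<And>z. z \<in> S \<Longrightarrow> (\<lambda>z. frechet_derivative f (at z) u) differentiable (at z)"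
    and t: "t > 0" "t * (norm u + norm v) < d"
  shows "\<exists>p\<in>ball x d. f (x + t *\<^sub>R u + t *\<^sub>R v) - f (x + t *\<^sub>R u) - f (x + t *\<^sub>R v) + f x =
           t * t * frechet_derivative (\<lambda>z. frechet_derivative f (at z) u) (at p) v"
proof -
  have mem: "x + s *\<^sub>R u + r *\<^sub>R v \<in> ball x d" if "0 \<le> s" "s \<le> t" "0 \<le> r" "r \<le> t" for s r
  proof -
    have "norm (s *\<^sub>R u + r *\<^sub>R v) \<le> s * norm u + r * norm v"
      using norm_triangle_ineq[of "s *\<^sub>R u" "r *\<^sub>R v"] that by simp
    also have "\<dots> \<le> t * norm u + t * norm v"
      using that by (intro add_mono mult_right_mono) auto
    also have "\<dots> < d" using t by (simp add: algebra_simps)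
    finally have "norm (s *\<^sub>R u + r *\<^sub>R v) < d" .
    moreover have "dist x (x + s *\<^sub>R u + r *\<^sub>R v) = norm (s *\<^sub>R u + r *\<^sub>R v)"
      by (metis add.assoc add_diff_cancel_left' dist_commute dist_norm)
    ultimately show ?thesis by simp
  qed
  let ?g = "\<lambda>z. frechet_derivative f (at z) u"
  let ?a = "\<lambda>s. f (x + t *\<^sub>R v + s *\<^sub>R u) - f (x + s *\<^sub>R u)"
  have "\<exists>s>0. s < t \<and> ?a t - ?a 0 = (t - 0) * (?g (x + t *\<^sub>R v + s *\<^sub>R u) - ?g (x + s *\<^sub>R u))"
  proof (rule MVT2[OF t(1)])
    fix s assume s: "0 \<le> s" "s \<le> t"
    have "x + t *\<^sub>R v + s *\<^sub>R u \<in> S" "x + s *\<^sub>R u \<in> S"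
      using mem[of s t] mem[of s 0] s t sub by (auto simp: algebra_simps)
    then show "(?a has_real_derivative ?g (x + t *\<^sub>R v + s *\<^sub>R u) - ?g (x + s *\<^sub>R u)) (at s)"
      by (intro DERIV_diff has_real_derivative_along_line f)
  qed
  then obtain s where s: "0 < s" "s < t"
    and eq1: "?a t - ?a 0 = t * (?g (x + t *\<^sub>R v + s *\<^sub>R u) - ?g (x + s *\<^sub>R u))" by auto
  let ?b = "\<lambda>r. ?g (x + s *\<^sub>R u + r *\<^sub>R v)"
  have "\<exists>r>0. r < t \<and> ?b t - ?b 0 = (t - 0) * frechet_derivative ?g (at (x + s *\<^sub>R u + r *\<^sub>R v)) v"
  proof (rule MVT2[OF t(1)])
    fix r assume r: "0 \<le> r" "r \<le> t"
    have "x + s *\<^sub>R u + r *\<^sub>R v \<in> S" using mem[of s r] r s sub by auto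
    then show "(?b has_real_derivative frechet_derivative ?g (at (x + s *\<^sub>R u + r *\<^sub>R v)) v) (at r)"
      by (intro has_real_derivative_along_line fu)
  qed
  then obtain r where r: "0 < r" "r < t"
    and eq2: "?b t - ?b 0 = t * frechet_derivative ?g (at (x + s *\<^sub>R u + r *\<^sub>R v)) v" by auto
  have "f (x + t *\<^sub>R u + t *\<^sub>R v) - f (x + t *\<^sub>R u) - f (x + t *\<^sub>R v) + f x = ?a t - ?a 0"
    by (simp add: algebra_simps)
  also have "\<dots> = t * (?b t - ?b 0)" using eq1 by (simp add: algebra_simps)
  also have "\<dots> = t * t * frechet_derivative ?g (at (x + s *\<^sub>R u + r *\<^sub>R v)) v"
    using eq2 by simp
  finally show ?thesis using mem[of s r] s r by auto
qed

text \<open>The second difference is unchanged when \<open>u\<close> and \<open>v\<close> are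
  swapped, so the two mixed derivatives take a common value at points \<open>p\<close> and
  \<open>q\<close> arbitrarily close to \<open>x\<close>; continuity at \<open>x\<close> does the
  rest.\<close>

lemma second_frechet_derivative_symmetric:
  fixes f :: "'a::real_normed_vector \<Rightarrow> real"
  assumes S: "open S" "x \<in> S" and f: "smooth_on S f"
  shows "frechet_derivative (\<lambda>z. frechet_derivative f (at z) u) (at x) v =
         frechet_derivative (\<lambda>z. frechet_derivative f (at z) v) (at x) u"
proof (rule ccontr)
  let ?D = "\<lambda>u v z. frechet_derivative (\<lambda>z. frechet_derivative f (at z) u) (at z) v"
  assume "?D u v x \<noteq> ?D v u x"
  \<comment> \<open>Half of the supposed gap: the equal values at \<open>p\<close> and
    \<open>q\<close> each lie within \<open>e\<close> of the values at \<open>x\<close>, so the gap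
    would be less than \<open>2 * e\<close>, which is itself.\<close>
  define e where "e = dist (?D u v x) (?D v u x) / 2"
  have e: "e > 0" using \<open>?D u v x \<noteq> ?D v u x\<close> by (simp add: e_def)
  have "smooth_on S (?D u v)" for u v
    by (intro smooth_on_frechet_derivative f)
  then have "continuous_on S (?D u v)" for u v
    unfolding smooth_on_def by (metis higher_differentiable_on.simps(1))
  then have cont: "isCont (?D u v) x" for u v
    using S continuous_on_eq_continuous_at by blast
  have *: "\<exists>d>0. \<forall>z. dist z x < d \<longrightarrow> dist (?D u v z) (?D u v x) < e" for u v
    using cont[of u v] e unfolding continuous_at_eps_delta by simp
  obtain d1 where d1: "d1 > 0" "\<And>z. dist z x < d1 \<Longrightarrow> dist (?D u v z) (?D u v x) < e"
    using *[of u v] by blast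
  obtain d2 where d2: "d2 > 0" "\<And>z. dist z x < d2 \<Longrightarrow> dist (?D v u z) (?D v u x) < e"
    using *[of v u] by blast
  obtain d3 where d3: "d3 > 0" "ball x d3 \<subseteq> S" using S openE by blast
  define d where "d = min d1 (min d2 d3)"
  have d: "d > 0" "d \<le> d1" "d \<le> d2" "ball x d \<subseteq> S"
    using d1 d2 d3 subset_ball[of d d3 x] by (auto simp: d_def)
  \<comment> \<open>The summand 1 keeps the denominator positive even if \<open>u\<close> and
    \<open>v\<close> both vanish.\<close>
  define t where "t = d / (2 * (norm u + norm v + 1))"
  have pos: "norm u + norm v + 1 > 0" using norm_ge_zero[of u] norm_ge_zero[of v] by linarith
  have t: "t > 0" using d pos by (simp add: t_def)
  have "t * (norm u + norm v) < t * (2 * (norm u + norm v + 1))"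
    using t pos by (intro mult_strict_left_mono) auto
  also have "\<dots> = d" using pos by (simp add: t_def)
  finally have tlt: "t * (norm u + norm v) < d" .
  then have tlt': "t * (norm v + norm u) < d" by (simp add: add.commute)
  have diff: "f differentiable (at z)" "(\<lambda>z. frechet_derivative f (at z) w) differentiable (at z)"
    if "z \<in> S" for z w
    using smooth_on_imp_differentiable[OF f that]
      smooth_on_imp_differentiable[OF smooth_on_frechet_derivative[OF f] that] by auto
  obtain p where p: "p \<in> ball x d"
    "f (x + t *\<^sub>R u + t *\<^sub>R v) - f (x + t *\<^sub>R u) - f (x + t *\<^sub>R v) + f x = t * t * ?D u v p"
    using second_difference_mean_value[OF d(4) diff t tlt] by blast
  obtain q where q: "q \<in> ball x d"
    "f (x + t *\<^sub>R v + t *\<^sub>R u) - f (x + t *\<^sub>R v) - f (x + t *\<^sub>R u) + f x = t * t * ?D v u q"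
    using second_difference_mean_value[OF d(4) diff t tlt'] by blast
  have "t * t * ?D u v p = t * t * ?D v u q"
    using p(2) q(2) by (simp add: algebra_simps)
  then have "?D u v p = ?D v u q" using t by simp
  moreover have "dist (?D u v x) (?D u v p) < e"
    using d1(2)[of p] p(1) d(2) by (simp add: dist_commute)
  moreover have "dist (?D v u x) (?D v u q) < e"
    using d2(2)[of q] q(1) d(3) by (simp add: dist_commute)
  ultimately have "dist (?D u v x) (?D v u x) < 2 * e"
    using dist_triangle_half_l[of _ _ "2 * e"] by simp
  then show False by (simp add: e_def)
qed

section \<open>Fibre derivatives\<close>

text \<open>A fibre direction is the direction \<open>(0, v)\<close> of the product space. A general
  \<open>v\<close> is allowed because Euler's relation needs the radial direction
  \<open>v = y\<close> besides the coordinate axes.\<close>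

lemma fibre_deriv_frechet:
  assumes "(\<lambda>(x, y). f x y) differentiable (at (x, y))"
  shows "((\<lambda>t. f x (y + t *\<^sub>R v)) has_real_derivative
            frechet_derivative (\<lambda>(x, y). f x y) (at (x, y)) (0, v)) (at 0)"
  using has_real_derivative_along_line[of "\<lambda>(x, y). f x y" "(x, y)" 0 "(0, v)"] assms
  by (simp add: case_prod_beta zero_prod_def[symmetric])

lemma fibre_deriv_eq_frechet:
  assumes "(\<lambda>(x, y). f x y) differentiable (at (x, y))"
  shows "fibre_deriv i f x y = frechet_derivative (\<lambda>(x, y). f x y) (at (x, y)) (0, axis i 1)"
  unfolding fibre_deriv_def using fibre_deriv_frechet[OF assms] by (rule DERIV_imp_deriv)

lemma smooth_on_fibre_deriv:
  assumes "open S" "smooth_on S (\<lambda>(x, y). f x y)"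
  shows "smooth_on S (\<lambda>(x, y). fibre_deriv i f x y)"
proof (rule smooth_on_cong[OF assms(1) _ smooth_on_frechet_derivative[OF assms(2)]])
  fix z assume "z \<in> S"
  then show "frechet_derivative (\<lambda>(x, y). f x y) (at z) (0, axis i 1) =
      (case z of (x, y) \<Rightarrow> fibre_deriv i f x y)"
    using fibre_deriv_eq_frechet[of f] smooth_on_imp_differentiable[OF assms(2)] by (cases z) simp
qed

lemma fibre_deriv_commute:
  assumes S: "open S" "(x, y) \<in> S" and f: "smooth_on S (\<lambda>(x, y). f x y)"
  shows "fibre_deriv i (fibre_deriv j f) x y = fibre_deriv j (fibre_deriv i f) x y"
proof -
  let ?f = "\<lambda>(x, y). f x y"
  have *: "fibre_deriv i (fibre_deriv j f) x y =
      frechet_derivative (\<lambda>z. frechet_derivative ?f (at z) (0, axis j 1)) (at (x, y)) (0, axis i 1)"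
    for i j
  proof -
    have d: "(\<lambda>(x, y). fibre_deriv j f x y) differentiable (at (x, y))"
      using smooth_on_imp_differentiable[OF smooth_on_fibre_deriv[OF S(1) f] S(2)] .
    have "(case z of (x, y) \<Rightarrow> fibre_deriv j f x y) = frechet_derivative ?f (at z) (0, axis j 1)"
      if "z \<in> S" for z
      using that fibre_deriv_eq_frechet[of f] smooth_on_imp_differentiable[OF f] by (cases z) simp
    \<comment> \<open>The inner fibre derivative equals a Frechet derivative only on
      \<open>S\<close>; openness of \<open>S\<close> allows the replacement under the outer
      derivative.\<close>
    from frechet_derivative_transform_within_open[OF d S this]
    show ?thesis by (simp add: fibre_deriv_eq_frechet[OF d])
  qed
  show ?thesis unfolding * by (rule second_frechet_derivative_symmetric[OF S f])
qed

lemma has_fibre_deriv: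
  assumes "(\<lambda>(x, y). f x y) differentiable (at (x, y))"
  shows "((\<lambda>t. f x (y + t *\<^sub>R axis k 1)) has_real_derivative fibre_deriv k f x y) (at 0)"
  using fibre_deriv_frechet[OF assms] fibre_deriv_eq_frechet[OF assms] by simp

text \<open>Identities on the slit bundle hold only for \<open>y \<noteq> 0\<close>. Since a short
  piece of any line through such a \<open>y\<close> avoids 0, they may nevertheless be
  differentiated.\<close>

lemma eventually_line_nonzero:
  fixes y v :: "'a::real_normed_vector"
  assumes "y \<noteq> 0"
  shows "eventually (\<lambda>t. y + t *\<^sub>R v \<noteq> 0) (nhds (0::real))"
proof -
  have "((\<lambda>t. y + t *\<^sub>R v) \<longlongrightarrow> y + 0 *\<^sub>R v) (nhds (0::real))"
    by (intro tendsto_intros filterlim_ident)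
  then show ?thesis
    using assms by (auto dest: tendsto_imp_eventually_ne)
qed

lemma fibre_deriv_cong:
  assumes "\<And>y. y \<noteq> 0 \<Longrightarrow> f x y = g x y" "y \<noteq> 0"
  shows "fibre_deriv k f x y = fibre_deriv k g x y"
  unfolding fibre_deriv_def
  by (rule deriv_cong_ev[OF eventually_mono[OF eventually_line_nonzero[OF assms(2)]] refl])
    (use assms(1) in auto)

text \<open>Along the ray \<open>y + t y = (1 + t) y\<close> the function is constant near
  \<open>t = 0\<close>, so its radial derivative vanishes; by linearity that derivative is the sum
  of the coordinate ones weighted by the components of \<open>y\<close>.\<close>

lemma euler_homogeneous_degree_zero:
  fixes f :: "real ^ 'n::finite \<Rightarrow> real ^ 'n \<Rightarrow> real"
  assumes d: "(\<lambda>(x, y). f x y) differentiable (at (x, y))"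
    and hom: "\<And>l. l > 0 \<Longrightarrow> f x (l *\<^sub>R y) = f x y"
  shows "(\<Sum>k\<in>UNIV. y $ k * fibre_deriv k f x y) = 0"
proof -
  let ?D = "frechet_derivative (\<lambda>(x, y). f x y) (at (x, y))"
  have lin: "linear ?D" using linear_frechet_derivative[OF d] .
  have "(0, y) = (\<Sum>k\<in>UNIV. y $ k *\<^sub>R (0::real ^ 'n, axis k 1 :: real ^ 'n))"
  proof -
    have "y = (\<Sum>k\<in>UNIV. y $ k *\<^sub>R axis k 1)"
      using basis_expansion[of y] by (simp add: scalar_mult_eq_scaleR)
    then show ?thesis by (simp add: prod_eq_iff fst_sum snd_sum)
  qed
  then have "?D (0, y) = (\<Sum>k\<in>UNIV. y $ k * ?D (0, axis k 1))"
    by (simp only: linear_sum[OF lin] linear_cmul[OF lin] real_scaleR_def)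
  moreover have "((\<lambda>t. f x (y + t *\<^sub>R y)) has_real_derivative ?D (0, y)) (at 0)"
    using fibre_deriv_frechet[OF d] .
  moreover have "((\<lambda>t. f x (y + t *\<^sub>R y)) has_real_derivative 0) (at 0)"
  proof (rule DERIV_cong_ev[THEN iffD1, OF refl _ refl DERIV_const])
    \<comment> \<open>Homogeneity is only for positive factors, here \<open>1 + t\<close>.\<close>
    have "eventually (\<lambda>t::real. t > -1) (nhds 0)"
      using eventually_nhds_in_open[of "{-1<..}" "0::real"] by simp
    then show "eventually (\<lambda>t. f x y = f x (y + t *\<^sub>R y)) (nhds 0)"
    proof eventually_elim
      case (elim t)
      then show ?case using hom[of "1 + t"] by (simp add: algebra_simps)
    qed
  qed
  ultimately have "(\<Sum>k\<in>UNIV. y $ k * ?D (0, axis k 1)) = 0"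
    using DERIV_unique[of "\<lambda>t. f x (y + t *\<^sub>R y)" "?D (0, y)" 0 0] by simp
  then show ?thesis by (simp add: fibre_deriv_eq_frechet[OF d])
qed

section \<open>Polynomial and rational functions on the fibres\<close>

lemma polynomial_in_fibreE:
  fixes P :: "real ^ 'n::finite \<Rightarrow> real ^ 'n \<Rightarrow> real"
  assumes "polynomial_in_fibre W P"
  obtains S :: "('n \<Rightarrow> nat) set" and c where "finite S" "\<forall>\<alpha>\<in>S. smooth_on W (c \<alpha>)"
    "\<forall>x\<in>W. \<forall>y. P x y = (\<Sum>\<alpha>\<in>S. c \<alpha> x * (\<Prod>i\<in>UNIV. (y $ i) ^ \<alpha> i))"
  using assms unfolding polynomial_in_fibre_def by blast

lemma polynomial_in_fibreI:
  assumes "finite S" "\<And>\<alpha>. \<alpha> \<in> S \<Longrightarrow> smooth_on W (c \<alpha>)"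
    "\<And>x y. x \<in> W \<Longrightarrow> P x y = (\<Sum>\<alpha>\<in>S. c \<alpha> x * (\<Prod>i\<in>UNIV. (y $ i) ^ \<alpha> i))"
  shows "polynomial_in_fibre W P"
  unfolding polynomial_in_fibre_def using assms by (intro exI[of _ S] exI[of _ c]) auto

lemma polynomial_in_fibre_subset:
  assumes "polynomial_in_fibre W P" "V \<subseteq> W"
  shows "polynomial_in_fibre V P"
  using assms(1)
proof (rule polynomial_in_fibreE)
  fix S :: "('a \<Rightarrow> nat) set" and c
  assume "finite S" "\<forall>\<alpha>\<in>S. smooth_on W (c \<alpha>)"
    "\<forall>x\<in>W. \<forall>y. P x y = (\<Sum>\<alpha>\<in>S. c \<alpha> x * (\<Prod>i\<in>UNIV. (y $ i) ^ \<alpha> i))"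
  then show ?thesis
    using assms(2) by (intro polynomial_in_fibreI[of S V c]) (auto intro: smooth_on_subset)
qed

lemma polynomial_in_fibre_cong:
  assumes "polynomial_in_fibre W P" "\<And>x y. x \<in> W \<Longrightarrow> Q x y = P x y"
  shows "polynomial_in_fibre W Q"
  using assms(1)
proof (rule polynomial_in_fibreE)
  fix S :: "('a \<Rightarrow> nat) set" and c
  assume "finite S" "\<forall>\<alpha>\<in>S. smooth_on W (c \<alpha>)"
    "\<forall>x\<in>W. \<forall>y. P x y = (\<Sum>\<alpha>\<in>S. c \<alpha> x * (\<Prod>i\<in>UNIV. (y $ i) ^ \<alpha> i))"
  then show ?thesis
    using assms(2) by (intro polynomial_in_fibreI[of S W c]) auto
qed

lemma polynomial_in_fibre_monomial:
  assumes "smooth_on W c"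
  shows "polynomial_in_fibre W (\<lambda>x y. c x * (\<Prod>i\<in>UNIV. (y $ i) ^ \<alpha> i))"
  by (rule polynomial_in_fibreI[of "{\<alpha>}" W "\<lambda>_. c"]) (simp_all add: assms)

lemma polynomial_in_fibre_const: "polynomial_in_fibre W (\<lambda>x y. c)"
  using polynomial_in_fibre_monomial[OF smooth_on_const[of W c], of "\<lambda>_. 0"] by simp

lemma polynomial_in_fibre_component:
  fixes k :: "'n::finite"
  shows "polynomial_in_fibre W (\<lambda>x y. y $ k)"
proof -
  have "(\<Prod>i\<in>UNIV. (y $ i) ^ (if i = k then 1 else 0)) = y $ k" for y :: "real ^ 'n"
    by (simp add: if_distrib[where f = "\<lambda>n. _ ^ n"] cong: if_cong)
  then show ?thesis
    using polynomial_in_fibre_monomial[OF smooth_on_const[of W 1], of "\<lambda>i. if i = k then 1 else 0"]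
    by simp
qed

lemma polynomial_in_fibre_add:
  assumes "open W" "polynomial_in_fibre W P" "polynomial_in_fibre W Q"
  shows "polynomial_in_fibre W (\<lambda>x y. P x y + Q x y)"
proof -
  obtain S :: "('a \<Rightarrow> nat) set" and c where P: "finite S" "\<forall>\<alpha>\<in>S. smooth_on W (c \<alpha>)"
    "\<forall>x\<in>W. \<forall>y. P x y = (\<Sum>\<alpha>\<in>S. c \<alpha> x * (\<Prod>i\<in>UNIV. (y $ i) ^ \<alpha> i))"
    using assms(2) by (rule polynomial_in_fibreE)
  obtain T :: "('a \<Rightarrow> nat) set" and d where Q: "finite T" "\<forall>\<alpha>\<in>T. smooth_on W (d \<alpha>)"
    "\<forall>x\<in>W. \<forall>y. Q x y = (\<Sum>\<alpha>\<in>T. d \<alpha> x * (\<Prod>i\<in>UNIV. (y $ i) ^ \<alpha> i))"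
    using assms(3) by (rule polynomial_in_fibreE)
  \<comment> \<open>Both coefficient families are extended by zero to the union of the exponent
    sets.\<close>
  let ?e = "\<lambda>\<alpha> x. (if \<alpha> \<in> S then c \<alpha> x else 0) + (if \<alpha> \<in> T then d \<alpha> x else 0)"
  have "smooth_on W (?e \<alpha>)" for \<alpha>
    using P(2) Q(2) smooth_on_const[of W 0]
    by (intro smooth_on_add assms(1); cases "\<alpha> \<in> S"; cases "\<alpha> \<in> T") auto
  moreover have "P x y + Q x y = (\<Sum>\<alpha>\<in>S\<union>T. ?e \<alpha> x * (\<Prod>i\<in>UNIV. (y $ i) ^ \<alpha> i))" if "x \<in> W" for x y
  proof -
    have "(\<Sum>\<alpha>\<in>S\<union>T. (if \<alpha> \<in> S then c \<alpha> x else 0) * (\<Prod>i\<in>UNIV. (y $ i) ^ \<alpha> i)) = P x y"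
      using that P by (auto intro!: sum.mono_neutral_cong_right Q)
    moreover have "(\<Sum>\<alpha>\<in>S\<union>T. (if \<alpha> \<in> T then d \<alpha> x else 0) * (\<Prod>i\<in>UNIV. (y $ i) ^ \<alpha> i)) = Q x y"
      using that Q by (auto intro!: sum.mono_neutral_cong_right P)
    ultimately show ?thesis by (simp add: distrib_right sum.distrib)
  qed
  ultimately show ?thesis
    using P(1) Q(1) by (intro polynomial_in_fibreI[of "S \<union> T" W ?e]) auto
qed

lemma polynomial_in_fibre_sum:
  "open W \<Longrightarrow> (\<And>i. i \<in> I \<Longrightarrow> polynomial_in_fibre W (P i)) \<Longrightarrow>
    polynomial_in_fibre W (\<lambda>x y. \<Sum>i\<in>I. P i x y)"
  by (induction I rule: infinite_finite_induct)
    (auto intro: polynomial_in_fibre_const polynomial_in_fibre_add)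

lemma polynomial_in_fibre_mult:
  assumes W: "open W" "polynomial_in_fibre W P" "polynomial_in_fibre W Q"
  shows "polynomial_in_fibre W (\<lambda>x y. P x y * Q x y)"
proof -
  obtain S :: "('a \<Rightarrow> nat) set" and c where P: "finite S" "\<forall>\<alpha>\<in>S. smooth_on W (c \<alpha>)"
    "\<forall>x\<in>W. \<forall>y. P x y = (\<Sum>\<alpha>\<in>S. c \<alpha> x * (\<Prod>i\<in>UNIV. (y $ i) ^ \<alpha> i))"
    using assms(2) by (rule polynomial_in_fibreE)
  obtain T :: "('a \<Rightarrow> nat) set" and d where Q: "finite T" "\<forall>\<alpha>\<in>T. smooth_on W (d \<alpha>)"
    "\<forall>x\<in>W. \<forall>y. Q x y = (\<Sum>\<alpha>\<in>T. d \<alpha> x * (\<Prod>i\<in>UNIV. (y $ i) ^ \<alpha> i))"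
    using assms(3) by (rule polynomial_in_fibreE)
  \<comment> \<open>Different pairs of exponents may have the same sum. Treating the product as a
    sum of monomials leaves the collection of like terms to closure under addition.\<close>
  have "polynomial_in_fibre W (\<lambda>x y. \<Sum>\<alpha>\<in>S. \<Sum>\<beta>\<in>T.
      (c \<alpha> x * d \<beta> x) * (\<Prod>i\<in>UNIV. (y $ i) ^ (\<alpha> i + \<beta> i)))"
    using P Q by (intro polynomial_in_fibre_sum polynomial_in_fibre_monomial smooth_on_mult W) auto
  then show ?thesis
    by (rule polynomial_in_fibre_cong)
      (use P Q in \<open>auto simp: sum_product power_add prod.distrib intro!: sum.cong\<close>)
qed

text \<open>Only the \<open>k\<close>-th factor moves along the line. If
  \<open>\<alpha> k = 0\<close>, the truncated exponent \<open>\<alpha> k - 1\<close> is 0 as well,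
  which is harmless because the coefficient vanishes.\<close>

lemma monomial_has_fibre_deriv:
  fixes y :: "real ^ 'n::finite"
  shows "((\<lambda>t. \<Prod>i\<in>UNIV. ((y + t *\<^sub>R axis k 1) $ i) ^ \<alpha> i) has_real_derivative
    real (\<alpha> k) * (\<Prod>i\<in>UNIV. (y $ i) ^ (\<alpha>(k := \<alpha> k - 1)) i)) (at 0)"
proof -
  have split: "(\<Prod>i\<in>UNIV. h i) = h k * (\<Prod>i\<in>UNIV - {k}. h i)" for h :: "'n \<Rightarrow> real"
    by (simp add: prod.remove)
  have 1: "(\<Prod>i\<in>UNIV. ((y + t *\<^sub>R axis k 1) $ i) ^ \<alpha> i) =
      (y $ k + t) ^ \<alpha> k * (\<Prod>i\<in>UNIV - {k}. (y $ i) ^ \<alpha> i)" for t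
    unfolding split by (auto simp: axis_def intro!: prod.cong)
  have 2: "(\<Prod>i\<in>UNIV. (y $ i) ^ (\<alpha>(k := \<alpha> k - 1)) i) =
      (y $ k) ^ (\<alpha> k - 1) * (\<Prod>i\<in>UNIV - {k}. (y $ i) ^ \<alpha> i)"
    unfolding split by (auto intro!: prod.cong)
  show ?thesis unfolding 1 2 by (auto intro!: derivative_eq_intros)
qed

text \<open>\<open>fibre_deriv\<close> is total, being defined through \<open>deriv\<close>; the
  second claim records that the derivative really exists, as the quotient rule requires.\<close>

lemma polynomial_in_fibre_deriv:
  fixes P :: "real ^ 'n::finite \<Rightarrow> real ^ 'n \<Rightarrow> real"
  assumes "open W" "polynomial_in_fibre W P"
  shows "polynomial_in_fibre W (fibre_deriv k P)"
    and "x \<in> W \<Longrightarrow>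
      ((\<lambda>t. P x (y + t *\<^sub>R axis k 1)) has_real_derivative fibre_deriv k P x y) (at 0)"
proof -
  obtain S :: "('n \<Rightarrow> nat) set" and c where P: "finite S" "\<forall>\<alpha>\<in>S. smooth_on W (c \<alpha>)"
    "\<forall>x\<in>W. \<forall>y. P x y = (\<Sum>\<alpha>\<in>S. c \<alpha> x * (\<Prod>i\<in>UNIV. (y $ i) ^ \<alpha> i))"
    using assms(2) by (rule polynomial_in_fibreE)
  let ?D = "\<lambda>x y. \<Sum>\<alpha>\<in>S. (c \<alpha> x * real (\<alpha> k)) * (\<Prod>i\<in>UNIV. (y $ i) ^ (\<alpha>(k := \<alpha> k - 1)) i)"
  have D: "((\<lambda>t. P x (y + t *\<^sub>R axis k 1)) has_real_derivative ?D x y) (at 0)" if "x \<in> W" for x y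
  proof -
    have "((\<lambda>t. \<Sum>\<alpha>\<in>S. c \<alpha> x * (\<Prod>i\<in>UNIV. ((y + t *\<^sub>R axis k 1) $ i) ^ \<alpha> i))
        has_real_derivative ?D x y) (at 0)"
      unfolding mult.assoc by (intro DERIV_sum DERIV_cmult monomial_has_fibre_deriv)
    then show ?thesis using P(3) that by simp
  qed
  have eq: "fibre_deriv k P x y = ?D x y" if "x \<in> W" for x y
    unfolding fibre_deriv_def using D[OF that] by (rule DERIV_imp_deriv)
  show "x \<in> W \<Longrightarrow>
      ((\<lambda>t. P x (y + t *\<^sub>R axis k 1)) has_real_derivative fibre_deriv k P x y) (at 0)"
    using D eq by simp
  have "polynomial_in_fibre W ?D"
    using P(2) by (intro polynomial_in_fibre_sum polynomial_in_fibre_monomial smooth_on_mult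
        smooth_on_const assms(1)) auto
  then show "polynomial_in_fibre W (fibre_deriv k P)"
    by (rule polynomial_in_fibre_cong) (rule eq)
qed

section \<open>Rational functions on the fibres and their closure under arithmetic\<close>

lemma rational_in_fibreE:
  assumes "rational_in_fibre D f" "x0 \<in> D"
  obtains W P Q where "open W" "x0 \<in> W" "W \<subseteq> D" "polynomial_in_fibre W P" "polynomial_in_fibre W Q"
    "\<forall>x\<in>W. \<forall>y. y \<noteq> 0 \<longrightarrow> Q x y \<noteq> 0 \<and> f x y = P x y / Q x y"
proof -
  obtain W P Q where *: "open W \<and> x0 \<in> W \<and> W \<subseteq> D \<and>
        polynomial_in_fibre W P \<and> polynomial_in_fibre W Q \<and>
        (\<forall>x\<in>W. \<forall>y. y \<noteq> 0 \<longrightarrow> Q x y \<noteq> 0 \<and> f x y = P x y / Q x y)"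
    using bspec[OF assms(1)[unfolded rational_in_fibre_def] assms(2)] by (elim exE)
  show thesis by (rule that[of W P Q]) (use * in auto)
qed

lemma rational_in_fibreI:
  assumes "\<And>x0. x0 \<in> D \<Longrightarrow> \<exists>W P Q. open W \<and> x0 \<in> W \<and> W \<subseteq> D \<and>
        polynomial_in_fibre W P \<and> polynomial_in_fibre W Q \<and>
        (\<forall>x\<in>W. \<forall>y. y \<noteq> 0 \<longrightarrow> Q x y \<noteq> 0 \<and> f x y = P x y / Q x y)"
  shows "rational_in_fibre D f"
  unfolding rational_in_fibre_def using assms by (rule ballI)

lemma rational_in_fibre_cong:
  assumes "rational_in_fibre D f" "\<And>x y. x \<in> D \<Longrightarrow> y \<noteq> 0 \<Longrightarrow> g x y = f x y"
  shows "rational_in_fibre D g"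
proof (rule rational_in_fibreI)
  fix x0 assume "x0 \<in> D"
  with assms(1) show "\<exists>W P Q. open W \<and> x0 \<in> W \<and> W \<subseteq> D \<and>
        polynomial_in_fibre W P \<and> polynomial_in_fibre W Q \<and>
        (\<forall>x\<in>W. \<forall>y. y \<noteq> 0 \<longrightarrow> Q x y \<noteq> 0 \<and> g x y = P x y / Q x y)"
  proof (rule rational_in_fibreE)
    fix W P Q
    assume "open W" "x0 \<in> W" "W \<subseteq> D" "polynomial_in_fibre W P" "polynomial_in_fibre W Q"
      "\<forall>x\<in>W. \<forall>y. y \<noteq> 0 \<longrightarrow> Q x y \<noteq> 0 \<and> f x y = P x y / Q x y"
    then show ?thesis
      using assms(2) by - (rule exI[of _ W], rule exI[of _ P], rule exI[of _ Q], auto)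
  qed
qed

lemma rational_in_fibre_polynomial:
  assumes "open D" "polynomial_in_fibre D P"
  shows "rational_in_fibre D P"
proof (rule rational_in_fibreI)
  fix x0 assume "x0 \<in> D"
  then show "\<exists>W P' Q. open W \<and> x0 \<in> W \<and> W \<subseteq> D \<and>
        polynomial_in_fibre W P' \<and> polynomial_in_fibre W Q \<and>
        (\<forall>x\<in>W. \<forall>y. y \<noteq> 0 \<longrightarrow> Q x y \<noteq> 0 \<and> P x y = P' x y / Q x y)"
    using assms
    by - (rule exI[of _ D], rule exI[of _ P], rule exI[of _ "\<lambda>x y. 1"],
        auto intro: polynomial_in_fibre_const)
qed

text \<open>Each function brings its own neighbourhood in the base. Passing to the intersection is
  done here once, so that the arithmetic operations reduce to fraction algebra over a common
  \<open>W\<close>.\<close>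

lemma rational_in_fibre_combine:
  assumes f: "rational_in_fibre D f" and g: "rational_in_fibre D g"
    and combine: "\<And>W P1 Q1 P2 Q2. open W \<Longrightarrow> W \<subseteq> D \<Longrightarrow>
      polynomial_in_fibre W P1 \<Longrightarrow> polynomial_in_fibre W Q1 \<Longrightarrow>
      polynomial_in_fibre W P2 \<Longrightarrow> polynomial_in_fibre W Q2 \<Longrightarrow>
      (\<And>x y. x \<in> W \<Longrightarrow> y \<noteq> 0 \<Longrightarrow> Q1 x y \<noteq> 0 \<and> Q2 x y \<noteq> 0 \<and>
         f x y = P1 x y / Q1 x y \<and> g x y = P2 x y / Q2 x y) \<Longrightarrow>
      \<exists>P Q. polynomial_in_fibre W P \<and> polynomial_in_fibre W Q \<and>
        (\<forall>x\<in>W. \<forall>y. y \<noteq> 0 \<longrightarrow> Q x y \<noteq> 0 \<and> h x y = P x y / Q x y)"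
  shows "rational_in_fibre D h"
proof (rule rational_in_fibreI)
  fix x0 assume x0: "x0 \<in> D"
  obtain V P1 Q1 where V: "open V" "x0 \<in> V" "V \<subseteq> D" "polynomial_in_fibre V P1"
    "polynomial_in_fibre V Q1" "\<forall>x\<in>V. \<forall>y. y \<noteq> 0 \<longrightarrow> Q1 x y \<noteq> 0 \<and> f x y = P1 x y / Q1 x y"
    using f x0 by (rule rational_in_fibreE)
  obtain U P2 Q2 where U: "open U" "x0 \<in> U" "U \<subseteq> D" "polynomial_in_fibre U P2"
    "polynomial_in_fibre U Q2" "\<forall>x\<in>U. \<forall>y. y \<noteq> 0 \<longrightarrow> Q2 x y \<noteq> 0 \<and> g x y = P2 x y / Q2 x y"
    using g x0 by (rule rational_in_fibreE)
  have "\<exists>P Q. polynomial_in_fibre (V \<inter> U) P \<and> polynomial_in_fibre (V \<inter> U) Q \<and>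
        (\<forall>x\<in>V \<inter> U. \<forall>y. y \<noteq> 0 \<longrightarrow> Q x y \<noteq> 0 \<and> h x y = P x y / Q x y)"
    (is "\<exists>P Q. ?R P Q")
    by (rule combine[of _ P1 Q1 P2 Q2])
      (use V U in \<open>auto intro: polynomial_in_fibre_subset open_Int\<close>)
  then obtain P Q where "?R P Q" by (elim exE)
  moreover have "open (V \<inter> U)" "x0 \<in> V \<inter> U" "V \<inter> U \<subseteq> D" using V U by auto
  ultimately show "\<exists>W P Q. open W \<and> x0 \<in> W \<and> W \<subseteq> D \<and>
        polynomial_in_fibre W P \<and> polynomial_in_fibre W Q \<and>
        (\<forall>x\<in>W. \<forall>y. y \<noteq> 0 \<longrightarrow> Q x y \<noteq> 0 \<and> h x y = P x y / Q x y)"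
    by - (rule exI[of _ "V \<inter> U"], rule exI[of _ P], rule exI[of _ Q], simp)
qed

lemma rational_in_fibre_add:
  assumes "rational_in_fibre D f" "rational_in_fibre D g"
  shows "rational_in_fibre D (\<lambda>x y. f x y + g x y)"
proof (rule rational_in_fibre_combine[OF assms])
  fix W P1 Q1 P2 Q2
  assume "open W" "polynomial_in_fibre W P1" "polynomial_in_fibre W Q1"
    "polynomial_in_fibre W P2" "polynomial_in_fibre W Q2"
    and "\<And>x y. x \<in> W \<Longrightarrow> y \<noteq> 0 \<Longrightarrow> Q1 x y \<noteq> 0 \<and> Q2 x y \<noteq> 0 \<and>
         f x y = P1 x y / Q1 x y \<and> g x y = P2 x y / Q2 x y"
  then show "\<exists>P Q. polynomial_in_fibre W P \<and> polynomial_in_fibre W Q \<and>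
        (\<forall>x\<in>W. \<forall>y. y \<noteq> 0 \<longrightarrow> Q x y \<noteq> 0 \<and> f x y + g x y = P x y / Q x y)"
    by - (rule exI[of _ "\<lambda>x y. P1 x y * Q2 x y + P2 x y * Q1 x y"], rule exI[of _ "\<lambda>x y. Q1 x y * Q2 x y"],
        auto intro!: polynomial_in_fibre_add polynomial_in_fibre_mult simp: add_frac_eq)
qed

lemma rational_in_fibre_mult:
  assumes "rational_in_fibre D f" "rational_in_fibre D g"
  shows "rational_in_fibre D (\<lambda>x y. f x y * g x y)"
proof (rule rational_in_fibre_combine[OF assms])
  fix W P1 Q1 P2 Q2
  assume "open W" "polynomial_in_fibre W P1" "polynomial_in_fibre W Q1"
    "polynomial_in_fibre W P2" "polynomial_in_fibre W Q2"
    and "\<And>x y. x \<in> W \<Longrightarrow> y \<noteq> 0 \<Longrightarrow> Q1 x y \<noteq> 0 \<and> Q2 x y \<noteq> 0 \<and>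
         f x y = P1 x y / Q1 x y \<and> g x y = P2 x y / Q2 x y"
  then show "\<exists>P Q. polynomial_in_fibre W P \<and> polynomial_in_fibre W Q \<and>
        (\<forall>x\<in>W. \<forall>y. y \<noteq> 0 \<longrightarrow> Q x y \<noteq> 0 \<and> f x y * g x y = P x y / Q x y)"
    by - (rule exI[of _ "\<lambda>x y. P1 x y * P2 x y"], rule exI[of _ "\<lambda>x y. Q1 x y * Q2 x y"],
        auto intro!: polynomial_in_fibre_mult)
qed

lemma rational_in_fibre_divide:
  assumes "rational_in_fibre D f" "rational_in_fibre D g"
    and nz: "\<And>x y. x \<in> D \<Longrightarrow> y \<noteq> 0 \<Longrightarrow> g x y \<noteq> 0"
  shows "rational_in_fibre D (\<lambda>x y. f x y / g x y)"
proof (rule rational_in_fibre_combine[OF assms(1,2)])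
  fix W P1 Q1 P2 Q2
  assume W: "open W" "W \<subseteq> D" "polynomial_in_fibre W P1" "polynomial_in_fibre W Q1"
    "polynomial_in_fibre W P2" "polynomial_in_fibre W Q2"
    and eq: "\<And>x y. x \<in> W \<Longrightarrow> y \<noteq> 0 \<Longrightarrow> Q1 x y \<noteq> 0 \<and> Q2 x y \<noteq> 0 \<and>
         f x y = P1 x y / Q1 x y \<and> g x y = P2 x y / Q2 x y"
  \<comment> \<open>The numerator of the divisor becomes part of the new denominator, hence must
    have no zero off \<open>y = 0\<close>.\<close>
  have "P2 x y \<noteq> 0" if "x \<in> W" "y \<noteq> 0" for x y
    using nz[of x y] eq[OF that] W(2) that by auto
  then show "\<exists>P Q. polynomial_in_fibre W P \<and> polynomial_in_fibre W Q \<and>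
        (\<forall>x\<in>W. \<forall>y. y \<noteq> 0 \<longrightarrow> Q x y \<noteq> 0 \<and> f x y / g x y = P x y / Q x y)"
    using W eq
    by - (rule exI[of _ "\<lambda>x y. P1 x y * Q2 x y"], rule exI[of _ "\<lambda>x y. Q1 x y * P2 x y"],
        auto intro!: polynomial_in_fibre_mult)
qed

lemma rational_in_fibre_const: "open D \<Longrightarrow> rational_in_fibre D (\<lambda>x y. c)"
  by (intro rational_in_fibre_polynomial polynomial_in_fibre_const)

lemma rational_in_fibre_component: "open D \<Longrightarrow> rational_in_fibre D (\<lambda>x y. y $ k)"
  by (intro rational_in_fibre_polynomial polynomial_in_fibre_component)

lemma rational_in_fibre_sum:
  "open D \<Longrightarrow> (\<And>i. i \<in> I \<Longrightarrow> rational_in_fibre D (f i)) \<Longrightarrow>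
    rational_in_fibre D (\<lambda>x y. \<Sum>i\<in>I. f i x y)"
  by (induction I rule: infinite_finite_induct)
    (auto intro: rational_in_fibre_const rational_in_fibre_add)

lemma rational_in_fibre_prod:
  "open D \<Longrightarrow> (\<And>i. i \<in> I \<Longrightarrow> rational_in_fibre D (f i)) \<Longrightarrow>
    rational_in_fibre D (\<lambda>x y. \<Prod>i\<in>I. f i x y)"
  by (induction I rule: infinite_finite_induct)
    (auto intro: rational_in_fibre_const rational_in_fibre_mult)

section \<open>Determinants and inverses of matrices with rational entries\<close>

lemma rational_in_fibre_det:
  fixes B :: "real ^ 'n::finite \<Rightarrow> real ^ 'n \<Rightarrow> real ^ 'k ^ 'k::finite"
  assumes "open D" "\<And>i j. rational_in_fibre D (\<lambda>x y. B x y $ i $ j)"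
  shows "rational_in_fibre D (\<lambda>x y. det (B x y))"
  unfolding det_def using assms
  by (intro rational_in_fibre_sum rational_in_fibre_mult rational_in_fibre_const
      rational_in_fibre_prod) auto

lemma matrix_inv_inverse:
  fixes B :: "real ^ 'n ^ 'n"
  assumes "det B \<noteq> 0"
  shows "B ** matrix_inv B = mat 1" "matrix_inv B ** B = mat 1"
proof -
  have "\<exists>C. B ** C = mat 1 \<and> C ** B = mat 1"
    using assms by (simp add: invertible_det_nz[symmetric] invertible_def)
  then have "B ** matrix_inv B = mat 1 \<and> matrix_inv B ** B = mat 1"
    unfolding matrix_inv_def by (rule someI_ex)
  then show "B ** matrix_inv B = mat 1" "matrix_inv B ** B = mat 1" by auto
qed

text \<open>The \<open>j\<close>-th column of the inverse solves the linear system with right-hand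
  side \<open>axis j 1\<close>, to which Cramer's rule applies. This turns the choice-based
  \<open>matrix_inv\<close> into a quotient of determinants.\<close>

lemma matrix_inv_cramer:
  fixes B :: "real ^ 'n ^ 'n"
  assumes "det B \<noteq> 0"
  shows "matrix_inv B $ i $ j = det (\<chi> k l. if l = i then axis j 1 $ k else B $ k $ l) / det B"
proof -
  have "B *v (matrix_inv B *v axis j 1) = axis j 1"
    by (simp add: matrix_vector_mul_assoc matrix_inv_inverse[OF assms])
  then have "matrix_inv B *v axis j 1 =
      (\<chi> i. det (\<chi> k l. if l = i then axis j 1 $ k else B $ k $ l) / det B)"
    using cramer[OF assms] by blast
  then show ?thesis
    by (simp add: matrix_vector_mult_basis column_def vec_eq_iff)
qed

lemma rational_in_fibre_matrix_inv:
  fixes B :: "real ^ 'n::finite \<Rightarrow> real ^ 'n \<Rightarrow> real ^ 'k ^ 'k::finite"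
  assumes D: "open D" and B: "\<And>i j. rational_in_fibre D (\<lambda>x y. B x y $ i $ j)"
    and nz: "\<And>x y. x \<in> D \<Longrightarrow> y \<noteq> 0 \<Longrightarrow> det (B x y) \<noteq> 0"
  shows "rational_in_fibre D (\<lambda>x y. matrix_inv (B x y) $ i $ j)"
proof (rule rational_in_fibre_cong)
  have "rational_in_fibre D (\<lambda>x y. (\<chi> k l. if l = i then axis j 1 $ k else B x y $ k $ l) $ k $ l)"
    for k l
    using B[of k l] rational_in_fibre_const[OF D, of "axis j 1 $ k"] by (cases "l = i") simp_all
  then show "rational_in_fibre D (\<lambda>x y.
      det (\<chi> k l. if l = i then axis j 1 $ k else B x y $ k $ l) / det (B x y))"
    by (intro rational_in_fibre_divide rational_in_fibre_det D B nz)
qed (use matrix_inv_cramer nz in blast)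

section \<open>Fibre derivatives of rational functions\<close>

lemma rational_has_fibre_deriv_quotient:
  fixes f :: "real ^ 'n::finite \<Rightarrow> real ^ 'n \<Rightarrow> real"
  assumes W: "open W" "polynomial_in_fibre W P" "polynomial_in_fibre W Q"
    and Q: "\<And>y. y \<noteq> 0 \<Longrightarrow> Q x y \<noteq> 0" and f: "\<And>y. y \<noteq> 0 \<Longrightarrow> f x y = P x y / Q x y"
    and x: "x \<in> W" "y \<noteq> 0"
  shows "((\<lambda>t. f x (y + t *\<^sub>R axis k 1)) has_real_derivative
    (fibre_deriv k P x y * Q x y - P x y * fibre_deriv k Q x y) / (Q x y * Q x y)) (at 0)"
proof -
  have "((\<lambda>t. P x (y + t *\<^sub>R axis k 1) / Q x (y + t *\<^sub>R axis k 1)) has_real_derivative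
    (fibre_deriv k P x y * Q x y - P x y * fibre_deriv k Q x y) / (Q x y * Q x y)) (at 0)"
    using DERIV_divide[OF polynomial_in_fibre_deriv(2)[OF W(1,2) x(1), of y k]
        polynomial_in_fibre_deriv(2)[OF W(1,3) x(1), of y k]] Q[OF x(2)] by simp
  moreover have "eventually (\<lambda>t. P x (y + t *\<^sub>R axis k 1) / Q x (y + t *\<^sub>R axis k 1) =
      f x (y + t *\<^sub>R axis k 1)) (nhds 0)"
    using eventually_line_nonzero[OF x(2), of "axis k 1"] by eventually_elim (simp add: f)
  ultimately show ?thesis
    by (simp add: DERIV_cong_ev[OF refl _ refl])
qed

text \<open>Existence of the derivative is what the product rule for
  \<open>h x y * a x y $ i $ j\<close> needs of \<open>a\<close>, which is given only as rational,
  not as smooth.\<close>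

lemma rational_has_fibre_deriv:
  assumes "rational_in_fibre D f" "x \<in> D" "y \<noteq> 0"
  shows "((\<lambda>t. f x (y + t *\<^sub>R axis k 1)) has_real_derivative fibre_deriv k f x y) (at 0)"
proof -
  obtain W P Q where W: "open W" "x \<in> W" "W \<subseteq> D" "polynomial_in_fibre W P"
    "polynomial_in_fibre W Q"
    "\<forall>x\<in>W. \<forall>y. y \<noteq> 0 \<longrightarrow> Q x y \<noteq> 0 \<and> f x y = P x y / Q x y"
    using assms(1,2) by (rule rational_in_fibreE)
  have "\<exists>d. ((\<lambda>t. f x (y + t *\<^sub>R axis k 1)) has_real_derivative d) (at 0)"
    using rational_has_fibre_deriv_quotient[OF W(1,4,5)] W assms(3) by blast
  then show ?thesis
    unfolding fibre_deriv_def using DERIV_imp_deriv by blast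
qed

lemma rational_in_fibre_deriv:
  assumes "rational_in_fibre D f"
  shows "rational_in_fibre D (fibre_deriv k f)"
proof (rule rational_in_fibre_combine[OF assms assms])
  fix W P Q P2 Q2
  assume W: "open W" "polynomial_in_fibre W P" "polynomial_in_fibre W Q"
    and eq: "\<And>x y. x \<in> W \<Longrightarrow> y \<noteq> 0 \<Longrightarrow> Q x y \<noteq> 0 \<and> Q2 x y \<noteq> 0 \<and>
         f x y = P x y / Q x y \<and> f x y = P2 x y / Q2 x y"
  \<comment> \<open>The difference is spelled with \<open>+ - 1 *\<close> so that closure under
    sums, products and constants covers it.\<close>
  have "fibre_deriv k f x y =
      (fibre_deriv k P x y * Q x y + - 1 * (P x y * fibre_deriv k Q x y)) / (Q x y * Q x y)"
    if "x \<in> W" "y \<noteq> 0" for x y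
    using DERIV_imp_deriv[OF rational_has_fibre_deriv_quotient[OF W, of x f y k]] eq that
    by (simp add: fibre_deriv_def)
  then show "\<exists>P Q. polynomial_in_fibre W P \<and> polynomial_in_fibre W Q \<and>
        (\<forall>x\<in>W. \<forall>y. y \<noteq> 0 \<longrightarrow> Q x y \<noteq> 0 \<and> fibre_deriv k f x y = P x y / Q x y)"
    using eq W
    by - (rule exI[of _ "\<lambda>x y. fibre_deriv k P x y * Q x y + - 1 * (P x y * fibre_deriv k Q x y)"],
        rule exI[of _ "\<lambda>x y. Q x y * Q x y"], intro conjI ballI allI impI
        polynomial_in_fibre_add polynomial_in_fibre_mult polynomial_in_fibre_const
        polynomial_in_fibre_deriv, auto)
qed

section \<open>The mean Cartan torsion\<close>

lemma inner_matrix_vector_mult: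
  fixes B :: "real ^ 'n ^ 'n::finite"
  shows "v \<bullet> (B *v v) = (\<Sum>i\<in>UNIV. \<Sum>j\<in>UNIV. v $ i * v $ j * B $ i $ j)"
  by (simp add: inner_vec_def matrix_vector_mult_def sum_distrib_left mult_ac)

text \<open>A nonzero kernel vector would make the quadratic form vanish.\<close>

lemma pos_definite_imp_det_nonzero:
  fixes B :: "real ^ 'n ^ 'n::finite"
  assumes "pos_definite B"
  shows "det B \<noteq> 0"
proof -
  have "\<forall>v. B *v v = 0 \<longrightarrow> v = 0"
    using assms unfolding pos_definite_def by (metis inner_zero_right less_irrefl)
  then show ?thesis
    by (simp add: invertible_det_nz[symmetric] invertible_left_inverse matrix_left_invertible_ker)
qed

lemma matrix_inv_eqI:
  fixes B C :: "real ^ 'n ^ 'n::finite"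
  assumes "B ** C = mat 1"
  shows "matrix_inv B = C"
proof -
  have "det B \<noteq> 0"
    using assms by (auto simp: invertible_det_nz[symmetric] invertible_right_inverse)
  then have "matrix_inv B ** B = mat 1" by (rule matrix_inv_inverse(2))
  then have "matrix_inv B = matrix_inv B ** (B ** C)" "matrix_inv B ** (B ** C) = C"
    by (simp add: assms, simp add: matrix_mul_assoc)
  then show ?thesis by simp
qed

lemma matrix_inv_scaleR:
  fixes B :: "real ^ 'n ^ 'n::finite"
  assumes "det B \<noteq> 0" "r \<noteq> 0"
  shows "matrix_inv (r *\<^sub>R B) = (1 / r) *\<^sub>R matrix_inv B"
proof (rule matrix_inv_eqI)
  have "B ** matrix_inv B = mat 1"
    using assms(1) by (rule matrix_inv_inverse(1))
  then show "(r *\<^sub>R B) ** ((1 / r) *\<^sub>R matrix_inv B) = mat 1"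
    using assms(2) by (simp add: matrix_scalar_ac scalar_matrix_assoc[symmetric])
qed

lemma pos_definite_quadratic_form:
  fixes B :: "real ^ 'n ^ 'n::finite"
  assumes "pos_definite B" "v \<noteq> 0"
  shows "(\<Sum>i\<in>UNIV. \<Sum>j\<in>UNIV. v $ i * v $ j * B $ i $ j) > 0"
  using assms unfolding pos_definite_def inner_matrix_vector_mult by blast

text \<open>Contracting \<open>deriv\<close> with \<open>y $ i * y $ j\<close> leaves 0 on the left,
  and positivity of the quadratic form of \<open>a\<close> permits solving for the derivative of
  \<open>h\<close>. Stating the result as a multiple of \<open>h\<close>, not as a logarithmic
  derivative, avoids dividing by \<open>h\<close>.\<close>

lemma conformal_factor_fibre_deriv:
  fixes G :: "'n::finite \<Rightarrow> 'n \<Rightarrow> real ^ 'n \<Rightarrow> real ^ 'n \<Rightarrow> real"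
  assumes y: "y \<noteq> 0"
    and diff: "\<And>i j. (\<lambda>(x, y). G i j x y) differentiable (at (x, y))"
    and sym: "\<And>i j k. fibre_deriv k (G i j) x y = fibre_deriv i (G k j) x y"
    and hom: "\<And>i j l. l > 0 \<Longrightarrow> G i j x (l *\<^sub>R y) = G i j x y"
    and deriv: "\<And>i j k. fibre_deriv k (G i j) x y =
      fibre_deriv k h x y * a x y $ i $ j + h x y * fibre_deriv k (\<lambda>x y. a x y $ i $ j) x y"
    and pos: "pos_definite (a x y)"
  shows "fibre_deriv k h x y =
    h x y * ((-1 * (\<Sum>i\<in>UNIV. \<Sum>j\<in>UNIV. y $ i * y $ j * fibre_deriv k (\<lambda>x y. a x y $ i $ j) x y)) /
      (\<Sum>i\<in>UNIV. \<Sum>j\<in>UNIV. y $ i * y $ j * a x y $ i $ j))"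
proof -
  let ?N = "\<Sum>i\<in>UNIV. \<Sum>j\<in>UNIV. y $ i * y $ j * fibre_deriv k (\<lambda>x y. a x y $ i $ j) x y"
  let ?Q = "\<Sum>i\<in>UNIV. \<Sum>j\<in>UNIV. y $ i * y $ j * a x y $ i $ j"
  \<comment> \<open>The symmetry trades the fixed differentiation index \<open>k\<close> for the
    summation index \<open>i\<close>, which makes the sum Euler's relation for
    \<open>G k j\<close>.\<close>
  have zero: "(\<Sum>i\<in>UNIV. y $ i * fibre_deriv k (G i j) x y) = 0" for j
    unfolding sym[of k] using euler_homogeneous_degree_zero[OF diff hom] by blast
  have "fibre_deriv k h x y * ?Q + h x y * ?N =
      (\<Sum>i\<in>UNIV. \<Sum>j\<in>UNIV. y $ j * (y $ i * fibre_deriv k (G i j) x y))"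
    unfolding deriv by (simp add: sum_distrib_left sum.distrib[symmetric] algebra_simps)
  also have "\<dots> = (\<Sum>j\<in>UNIV. y $ j * (\<Sum>i\<in>UNIV. y $ i * fibre_deriv k (G i j) x y))"
    by (subst sum.swap) (simp add: sum_distrib_left)
  also have "\<dots> = 0" by (simp add: zero)
  finally show ?thesis
    using pos_definite_quadratic_form[OF pos y] by (simp add: field_simps)
qed

theorem proposition3p7:
  fixes M :: "'m topology"
    and A :: "('m, 'n::finite) chart set"
    and F :: "('m, 'n) tangent_vector \<Rightarrow> real"
  assumes "smooth_manifold M A"
    and "AR_finsler_metric M A F"
  shows "\<forall>c\<in>A. \<forall>k. rational_in_fibre (coord_range c) (mean_cartan_torsion A c F k)"
proof (intro ballI allI)
  fix c k assume c: "c \<in> A"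
  let ?D = "coord_range c" and ?g = "metric_tensor A c F"
  let ?S = "?D \<times> (UNIV - {0 :: real ^ 'n})"
  have D: "open ?D"
    using assms(1) c unfolding smooth_manifold_def is_chart_def by blast
  then have S: "open ?S" by (intro open_Times) auto
  have fin: "finsler_metric M A F" using assms(2) unfolding AR_finsler_metric_def by (elim conjE)
  obtain \<eta> where \<eta>: "smooth_on_slit A \<eta>"
    and "\<exists>a :: real ^ 'n \<Rightarrow> real ^ 'n \<Rightarrow> real ^ 'n ^ 'n.
      (\<forall>x\<in>?D. \<forall>y. y \<noteq> 0 \<longrightarrow> transpose (a x y) = a x y \<and> pos_definite (a x y)) \<and>
      (\<forall>i j. rational_in_fibre ?D (\<lambda>x y. a x y $ i $ j)) \<and>
      (\<forall>x\<in>?D. \<forall>y. y \<noteq> 0 \<longrightarrow> (\<forall>l>0. \<forall>i j.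
        local_rep A c \<eta> x (l *\<^sub>R y) * a x (l *\<^sub>R y) $ i $ j = local_rep A c \<eta> x y * a x y $ i $ j)) \<and>
      (\<forall>x\<in>?D. \<forall>y. y \<noteq> 0 \<longrightarrow> (\<forall>i j. ?g x y $ i $ j = local_rep A c \<eta> x y * a x y $ i $ j))"
    using assms(2) c unfolding AR_finsler_metric_def by (elim conjE exE) (drule bspec, assumption+)
  then obtain a :: "real ^ 'n \<Rightarrow> real ^ 'n \<Rightarrow> real ^ 'n ^ 'n" where
      pos: "\<forall>x\<in>?D. \<forall>y. y \<noteq> 0 \<longrightarrow> transpose (a x y) = a x y \<and> pos_definite (a x y)"
    and rat: "\<forall>i j. rational_in_fibre ?D (\<lambda>x y. a x y $ i $ j)"
    and hom: "\<forall>x\<in>?D. \<forall>y. y \<noteq> 0 \<longrightarrow> (\<forall>l>0. \<forall>i j.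
      local_rep A c \<eta> x (l *\<^sub>R y) * a x (l *\<^sub>R y) $ i $ j = local_rep A c \<eta> x y * a x y $ i $ j)"
    and g: "\<forall>x\<in>?D. \<forall>y. y \<noteq> 0 \<longrightarrow> (\<forall>i j. ?g x y $ i $ j = local_rep A c \<eta> x y * a x y $ i $ j)"
    by (elim conjE exE)
  define h where "h = local_rep A c \<eta>"
  note hom = hom[folded h_def] and g = g[folded h_def]
  have h_smooth: "smooth_on ?S (\<lambda>(x, y). h x y)"
    using \<eta> c unfolding smooth_on_slit_def h_def by (rule bspec)
  define L where "L = local_rep A c (\<lambda>w. (F w)\<^sup>2)"
  have "smooth_on ?S (\<lambda>(x, y). local_rep A c F x y)"
    using fin c unfolding finsler_metric_def smooth_on_slit_def by blast
  from smooth_on_mult[OF S this this] have L: "smooth_on ?S (\<lambda>(x, y). L x y)"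
    by (rule smooth_on_cong[OF S, rotated])
      (auto simp: L_def local_rep_def power2_eq_square)
  define G where "G = (\<lambda>i j x y. ?g x y $ i $ j)"
  have G_L: "G i j = (\<lambda>x y. 1/2 * fibre_deriv i (fibre_deriv j L) x y)" for i j
    by (simp add: G_def metric_tensor_def L_def)
  note L2 = smooth_on_fibre_deriv[OF S smooth_on_fibre_deriv[OF S L]]
  have G_smooth: "smooth_on ?S (\<lambda>(x, y). G i j x y)" for i j
    by (rule smooth_on_cong[OF S _ smooth_on_mult[OF S smooth_on_const[of _ "1/2"] L2[of i j]]])
      (auto simp: G_L)
  have G_sym: "fibre_deriv k (G i j) x y = fibre_deriv i (G k j) x y" if "x \<in> ?D" "y \<noteq> 0" for i j k x y
  proof -
    \<comment> \<open>Pulling the factor 1/2 out of \<open>deriv\<close> requires the second fibre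
      derivatives of \<open>L\<close> to be differentiable, which smoothness of \<open>L\<close>
      provides.\<close>
    have half: "fibre_deriv k (G i j) x y = 1/2 * fibre_deriv k (fibre_deriv i (fibre_deriv j L)) x y"
      for i j k
      using DERIV_imp_deriv[OF DERIV_cmult[OF has_fibre_deriv[OF
            smooth_on_imp_differentiable[OF L2, of "(x, y)" i j]], of "1/2" k]] that
      by (simp add: G_L fibre_deriv_def[of k "\<lambda>x y. fibre_deriv i (fibre_deriv j L) x y / 2"])
    show ?thesis
      unfolding half using that
      by (subst fibre_deriv_commute[OF S _ smooth_on_fibre_deriv[OF S L]]) auto
  qed
  have G_deriv: "fibre_deriv k (G i j) x y =
      fibre_deriv k h x y * a x y $ i $ j + h x y * fibre_deriv k (\<lambda>x y. a x y $ i $ j) x y"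
    if xy: "x \<in> ?D" "y \<noteq> 0" for i j k x y
  proof -
    have h': "((\<lambda>t. h x (y + t *\<^sub>R axis k 1)) has_real_derivative fibre_deriv k h x y) (at 0)"
      by (rule has_fibre_deriv[OF smooth_on_imp_differentiable[OF h_smooth]]) (use xy in simp)
    have a': "((\<lambda>t. a x (y + t *\<^sub>R axis k 1) $ i $ j) has_real_derivative
        fibre_deriv k (\<lambda>x y. a x y $ i $ j) x y) (at 0)"
      using rational_has_fibre_deriv[OF rat[rule_format, of i j] xy] .
    \<comment> \<open>The factorization holds only off the zero section, so the two functions are
      compared near \<open>y\<close> only.\<close>
    have "fibre_deriv k (G i j) x y = fibre_deriv k (\<lambda>x y. h x y * a x y $ i $ j) x y"
      using g xy by (intro fibre_deriv_cong) (auto simp: G_def)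
    also have "\<dots> = fibre_deriv k h x y * a x y $ i $ j +
        h x y * fibre_deriv k (\<lambda>x y. a x y $ i $ j) x y"
      using DERIV_imp_deriv[OF DERIV_mult[OF h' a']]
      by (simp add: fibre_deriv_def[of k "\<lambda>x y. h x y * a x y $ i $ j"] mult.commute)
    finally show ?thesis .
  qed
  \<comment> \<open>This is the logarithmic fibre derivative of \<open>h\<close>, written in terms
    of \<open>a\<close> alone; \<open>-1 *\<close> again serves the closure rules.\<close>
  define \<rho> where "\<rho> = (\<lambda>x y. (-1 * (\<Sum>i\<in>UNIV. \<Sum>j\<in>UNIV.
      y $ i * y $ j * fibre_deriv k (\<lambda>x y. a x y $ i $ j) x y)) /
      (\<Sum>i\<in>UNIV. \<Sum>j\<in>UNIV. y $ i * y $ j * a x y $ i $ j))"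
  have h_deriv: "fibre_deriv k h x y = h x y * \<rho> x y" if xy: "x \<in> ?D" "y \<noteq> 0" for x y
    unfolding \<rho>_def
  proof (rule conformal_factor_fibre_deriv[OF xy(2) _ G_sym[OF xy] _ G_deriv[OF xy]])
    show "(\<lambda>(x, y). G i j x y) differentiable at (x, y)" for i j
      using smooth_on_imp_differentiable[OF G_smooth] xy by simp
    show "G i j x (l *\<^sub>R y) = G i j x y" if "l > 0" for i j l
      using hom g xy that by (simp add: G_def)
    show "pos_definite (a x y)" using pos xy by blast
  qed
  have \<rho>_rat: "rational_in_fibre ?D \<rho>"
    unfolding \<rho>_def
  proof (rule rational_in_fibre_divide)
    show "(\<Sum>i\<in>UNIV. \<Sum>j\<in>UNIV. y $ i * y $ j * a x y $ i $ j) \<noteq> 0" if "x \<in> ?D" "y \<noteq> 0" for x y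
      using pos_definite_quadratic_form[of "a x y" y] pos that by (metis less_irrefl)
  qed (intro rational_in_fibre_sum rational_in_fibre_mult rational_in_fibre_const
      rational_in_fibre_component rational_in_fibre_deriv D rat[rule_format])+
  show "rational_in_fibre ?D (mean_cartan_torsion A c F k)"
  proof (rule rational_in_fibre_cong)
    \<comment> \<open>This is the mean torsion after cancellation: the inverse metric carries
      \<open>1 / h x y\<close>, and the Cartan torsion carries \<open>h x y\<close> once its
      derivative is replaced by \<open>h x y * \<rho> x y\<close>.\<close>
    show "rational_in_fibre ?D (\<lambda>x y. \<Sum>i\<in>UNIV. \<Sum>j\<in>UNIV. matrix_inv (a x y) $ i $ j *
        (1/2 * (\<rho> x y * a x y $ i $ j + fibre_deriv k (\<lambda>x y. a x y $ i $ j) x y)))"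
      using pos pos_definite_imp_det_nonzero
      by (intro rational_in_fibre_sum rational_in_fibre_mult rational_in_fibre_matrix_inv
          rational_in_fibre_add rational_in_fibre_deriv rational_in_fibre_const \<rho>_rat D
          rat[rule_format]) blast
  next
    fix x y assume xy: "x \<in> ?D" "y \<noteq> (0 :: real ^ 'n)"
    have g_eq: "?g x y = h x y *\<^sub>R a x y" using g xy by (simp add: vec_eq_iff)
    have "pos_definite (?g x y)" using fin c xy unfolding finsler_metric_def by blast
    \<comment> \<open>If \<open>h x y\<close> were 0, the metric would be the zero matrix, which
      fails positive definiteness on the nonzero vector \<open>y\<close>.\<close>
    then have h0: "h x y \<noteq> 0"
      using xy(2) g_eq by (auto simp: pos_definite_def)
    have "det (a x y) \<noteq> 0" using pos xy pos_definite_imp_det_nonzero by blast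
    then have inv: "matrix_inv (?g x y) $ i $ j = 1 / h x y * matrix_inv (a x y) $ i $ j" for i j
      by (simp add: g_eq matrix_inv_scaleR[OF _ h0])
    have torsion: "cartan_torsion A c F i j k x y = h x y *
        (1/2 * (\<rho> x y * a x y $ i $ j + fibre_deriv k (\<lambda>x y. a x y $ i $ j) x y))" for i j
      using G_deriv[OF xy, of k i j] h_deriv[OF xy]
      by (simp add: cartan_torsion_def G_def algebra_simps)
    show "mean_cartan_torsion A c F k x y =
        (\<Sum>i\<in>UNIV. \<Sum>j\<in>UNIV. matrix_inv (a x y) $ i $ j *
        (1/2 * (\<rho> x y * a x y $ i $ j + fibre_deriv k (\<lambda>x y. a x y $ i $ j) x y)))"
      unfolding mean_cartan_torsion_def inv torsion using h0 by (intro sum.cong refl) simp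
  qed
qed

end
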